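(* Let $c_1>c_2>1$ be reals. Define $\delta=\left(\frac{c_2}{5c_1}\right)^{\frac{c_2}{c_2-1}}$. Let $G$ be a random graph drawn from the probability distribution $G\left(n,\frac{c_1}{n}\right)$. Then, with probability tending to $1$ as $n\to\infty$, for every integer $k$ with $1\le k\le \delta n$, every set of $k$ vertices of $G$ spans fewer than $c_2k$ edges.
   Context: $G(n,p)$ is the binomial random graph on $n$ labelled vertices, in which each of the $\binom{n}{2}$ possible edges appears independently with probability $p$. The number of edges spanned by a vertex set is the number of edges with both endpoints in that set. The constants $c_1,c_2$ are fixed as $n\to\infty$. *)

theory Defs
  imports "HOL-Probability.Probability"
begin

definition vertex_pairs :: "nat \<Rightarrow> nat set set" where
  "vertex_pairs n = {e. e \<subseteq> {1..n} \<and> card e = 2}"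

(* A simple graph on the fixed vertex set {1..n} is represented by its set of edges.
   For a real outside [0,1], bernoulli_pmf truncates the parameter to [0,1]; with
   edge probability c/n this concerns only the finitely many n < c. *)
definition gnp :: "nat \<Rightarrow> real \<Rightarrow> nat set set pmf" where
  "gnp n p = map_pmf (\<lambda>f. {e \<in> vertex_pairs n. f e})
     (Pi_pmf (vertex_pairs n) False (\<lambda>_. bernoulli_pmf p))"

definition spanned_edges :: "'a set set \<Rightarrow> 'a set \<Rightarrow> 'a set set" where
  "spanned_edges E S = {e \<in> E. e \<subseteq> S}"

end

theory Submission
  imports Defs
begin

text \<open>
  The proof is a first-moment argument. If some \<open>k\<close>-set spans at least \<open>c2 * k\<close> edges, then all
  of some \<open>m = \<lceil>c2 * k\<rceil>\<close> pairs inside it are edges, so the probability of this is at most the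
  expected number of such configurations,
  \<open>(n choose k) * ((k choose 2) choose m) * (c1 / n) ^ m\<close> (\<open>prob_dense_set_le\<close>).
  By \<open>n choose k \<le> (e * n / k) ^ k\<close>, for \<open>k \<le> \<delta> * n\<close> this is at most the \<open>k\<close>-th power of
  \<open>e / x * (e * c1 * x / (2 * c2)) powr c2\<close> with \<open>x = k / n\<close>, a constant multiple of
  \<open>x powr (c2 - 1)\<close>. The threshold \<open>\<delta>\<close> is the number for which
  \<open>\<delta> powr (c2 - 1) = (c2 / (5 * c1)) powr c2\<close>; relative to it the base becomes
  \<open>e * (e / 10) powr c2 * (x / \<delta>) powr (c2 - 1)\<close>, whose constant is at most
  \<open>e * e / 10 \<le> 9 / 10\<close> (\<open>expected_dense_sets_le\<close>).

  It remains to sum over \<open>1 \<le> k \<le> \<delta> * n\<close>. Each single term tends to \<open>0\<close>, because for fixed \<open>k\<close>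
  the ratio \<open>x / \<delta>\<close> does and \<open>c2 > 1\<close>; and all terms are dominated by the geometric series of ratio
  \<open>9 / 10\<close>. Hence the sum tends to \<open>0\<close> by Tannery's theorem (\<open>sum_dense_bound_tendsto_0\<close>).
\<close>

lemma finite_vertex_pairs: "finite (vertex_pairs n)"
  by (rule finite_subset[of _ "Pow {1..n}"]) (auto simp: vertex_pairs_def)

lemma set_pmf_gnp_subset: "E \<in> set_pmf (gnp n p) \<Longrightarrow> E \<subseteq> vertex_pairs n"
  by (auto simp: gnp_def)

text \<open>
  In terms of the independent edge indicators, containing \<open>T\<close> is a product event that forces the
  indicators in \<open>T\<close> and leaves the others free.
\<close>
lemma prob_gnp_superset:
  assumes T: "T \<subseteq> vertex_pairs n" and p: "0 \<le> p" "p \<le> 1"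
  shows "measure_pmf.prob (gnp n p) {E. T \<subseteq> E} = p ^ card T"
proof -
  let ?V = "vertex_pairs n"
  have "(\<lambda>f. {e \<in> ?V. f e}) -` {E. T \<subseteq> E} = Pi ?V (\<lambda>e. if e \<in> T then {True} else UNIV)"
    using T by (auto simp: Pi_def split: if_splits)
  then have "measure_pmf.prob (gnp n p) {E. T \<subseteq> E} =
      (\<Prod>e\<in>?V. measure_pmf.prob (bernoulli_pmf p) (if e \<in> T then {True} else UNIV))"
    by (simp add: gnp_def measure_Pi_pmf_Pi finite_vertex_pairs)
  also have "\<dots> = (\<Prod>e\<in>?V. if e \<in> T then p else 1)"
    using p by (intro prod.cong) (auto simp: measure_pmf_single)
  also have "\<dots> = p ^ card T"
    using T by (simp add: prod.If_cases finite_vertex_pairs Int_absorb1 Collect_mem_eq)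
  finally show ?thesis .
qed

text \<open>Union bound over the \<open>m\<close>-sets of pairs inside \<open>S\<close> that could all be present.\<close>
lemma prob_many_spanned_edges_le:
  fixes p :: real
  assumes S: "S \<subseteq> {1..n}" and p: "0 \<le> p" "p \<le> 1"
  shows "measure_pmf.prob (gnp n p) {E. m \<le> card (spanned_edges E S)}
           \<le> real ((card S choose 2) choose m) * p ^ m"
proof -
  let ?P = "{e. e \<subseteq> S \<and> card e = 2}"
  let ?\<T> = "{T. T \<subseteq> ?P \<and> card T = m}"
  have finS: "finite S" using S finite_subset by blast
  then have finP: "finite ?P" by simp
  then have fin\<T>: "finite ?\<T>" by simp
  have PV: "?P \<subseteq> vertex_pairs n" using S by (auto simp: vertex_pairs_def)
  have sub: "{E. m \<le> card (spanned_edges E S)} \<inter> set_pmf (gnp n p) \<subseteq> (\<Union>T\<in>?\<T>. {E. T \<subseteq> E})"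
  proof safe
    fix E assume E: "m \<le> card (spanned_edges E S)" "E \<in> set_pmf (gnp n p)"
    obtain T where T: "T \<subseteq> spanned_edges E S" "card T = m"
      using obtain_subset_with_card_n[OF E(1)] by metis
    with set_pmf_gnp_subset[OF E(2)] have "T \<subseteq> ?P" "T \<subseteq> E"
      by (auto simp: spanned_edges_def vertex_pairs_def)
    with T show "E \<in> (\<Union>T\<in>?\<T>. {E. T \<subseteq> E})" by blast
  qed
  have "measure_pmf.prob (gnp n p) {E. m \<le> card (spanned_edges E S)}
      = measure_pmf.prob (gnp n p) ({E. m \<le> card (spanned_edges E S)} \<inter> set_pmf (gnp n p))"
    by (simp add: measure_Int_set_pmf)
  also have "\<dots> \<le> measure_pmf.prob (gnp n p) (\<Union>T\<in>?\<T>. {E. T \<subseteq> E})"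
    by (rule measure_pmf.finite_measure_mono[OF sub]) simp
  also have "\<dots> \<le> (\<Sum>T\<in>?\<T>. measure_pmf.prob (gnp n p) {E. T \<subseteq> E})"
    by (rule measure_pmf.finite_measure_subadditive_finite[OF fin\<T>]) simp
  also have "\<dots> = (\<Sum>T\<in>?\<T>. p ^ m)"
    using PV p by (intro sum.cong refl) (subst prob_gnp_superset, auto)
  also have "\<dots> = real ((card S choose 2) choose m) * p ^ m"
    by (simp add: n_subsets finP finS)
  finally show ?thesis .
qed

text \<open>Union bound over the vertex sets of size \<open>k\<close>.\<close>
lemma prob_dense_set_le:
  fixes p :: real
  assumes p: "0 \<le> p" "p \<le> 1"
  shows "measure_pmf.prob (gnp n p)
             {E. \<exists>S. S \<subseteq> {1..n} \<and> card S = k \<and> m \<le> card (spanned_edges E S)}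
           \<le> real (n choose k) * (real ((k choose 2) choose m) * p ^ m)"
proof -
  let ?\<S> = "{S. S \<subseteq> {1..n} \<and> card S = k}"
  have "{E. \<exists>S. S \<subseteq> {1..n} \<and> card S = k \<and> m \<le> card (spanned_edges E S)}
      = (\<Union>S\<in>?\<S>. {E. m \<le> card (spanned_edges E S)})" by auto
  also have "measure_pmf.prob (gnp n p) \<dots>
      \<le> (\<Sum>S\<in>?\<S>. measure_pmf.prob (gnp n p) {E. m \<le> card (spanned_edges E S)})"
    by (rule measure_pmf.finite_measure_subadditive_finite) auto
  also have "\<dots> \<le> (\<Sum>S\<in>?\<S>. real ((k choose 2) choose m) * p ^ m)"
    by (intro sum_mono) (use p prob_many_spanned_edges_le in auto)
  also have "\<dots> = real (n choose k) * (real ((k choose 2) choose m) * p ^ m)"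
    by (simp add: n_subsets)
  finally show ?thesis .
qed

text \<open>The left-hand side divided by \<open>fact k\<close> is a single term of the exponential series at \<open>k\<close>.\<close>
lemma power_self_le_exp_fact: "real k ^ k \<le> exp (real k) * fact k"
proof -
  have "(\<Sum>n\<in>{k}. real k ^ n /\<^sub>R fact n) \<le> (\<Sum>n. real k ^ n /\<^sub>R fact n)"
    by (rule sum_le_suminf[OF summable_exp_generic]) auto
  then show ?thesis by (simp add: exp_def field_simps)
qed

lemma binomial_le_exp_power: "real (n choose k) \<le> (exp 1 * real n / real k) ^ k"
proof (cases "k = 0")
  case False
  have "real (n choose k) * real k ^ k \<le> real (n choose k) * (exp (real k) * fact k)"
    by (intro mult_left_mono power_self_le_exp_fact) simp
  also have "\<dots> = exp (real k) * real ((n choose k) * fact k)" by simp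
  also have "\<dots> \<le> exp (real k) * real (n ^ k)"
    by (intro mult_left_mono of_nat_mono binomial_fact_pow) simp
  also have "\<dots> = (exp 1 * real n) ^ k"
    by (simp add: power_mult_distrib flip: exp_of_nat_mult)
  finally show ?thesis using False by (simp add: power_divide field_simps)
qed simp

text \<open>
  The estimate that explains the value of \<open>\<delta>\<close>. With \<open>X = e * c1 * x / (2 * c2)\<close>, the edge factor is
  at most \<open>X ^ m\<close>. Passing from the integer \<open>m\<close> to the real exponent \<open>c2 * k \<le> m\<close> needs \<open>X \<le> 1\<close>,
  which holds because \<open>\<delta>\<close> is at most \<open>a = c2 / (5 * c1)\<close> and so \<open>X = e / 10 * (x / a) \<le> e / 10\<close>.
\<close>
lemma expected_dense_sets_le:
  fixes c1 c2 \<delta> :: real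
  assumes c: "c1 > c2" "c2 > 1"
    and \<delta>: "\<delta> = (c2 / (5 * c1)) powr (c2 / (c2 - 1))"
    and k: "1 \<le> k" "real k \<le> \<delta> * real n"
    and m: "c2 * real k \<le> real m"
  shows "real (n choose k) * (real ((k choose 2) choose m) * (c1 / n) ^ m)
           \<le> (9 / 10 * (real k / (\<delta> * real n)) powr (c2 - 1)) ^ k"
proof -
  define a where "a = c2 / (5 * c1)"
  define x where "x = real k / real n"
  define X where "X = exp 1 * c1 * x / (2 * c2)"
  have a: "0 < a" "a < 1" using c by (auto simp: a_def field_simps)
  have \<delta>0: "0 < \<delta>" using a by (simp add: \<delta> flip: a_def)
  have n: "0 < n" using k \<delta>0 by (cases n) auto
  have x: "0 < x" "x \<le> \<delta>" using k n by (auto simp: x_def field_simps)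
  have "\<delta> \<le> a powr 1"
    unfolding \<delta> a_def[symmetric] using a c by (intro powr_mono') (auto simp: field_simps)
  then have \<delta>a: "\<delta> \<le> a" using a by simp
  have \<delta>_powr: "\<delta> powr (c2 - 1) = a powr c2"
    using c by (simp add: \<delta> powr_powr flip: a_def)
  have X_eq: "X = exp 1 / 10 * (x / a)"
    using c by (simp add: X_def a_def)
  have e10: "exp 1 / 10 \<le> (3 / 10 :: real)" using exp_le by simp
  have X0: "0 < X" using x a by (simp add: X_eq)
  have "X \<le> 3 / 10 * 1"
    unfolding X_eq using x \<delta>a a e10 by (intro mult_mono) auto
  then have X1: "X \<le> 1" by simp
  have m0: "0 < real m" using c k m by (smt (verit) mult_pos_pos of_nat_1 of_nat_mono)
  have choose2: "real (k choose 2) \<le> real k ^ 2 / 2"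
  proof -
    have "2 * (k choose 2) \<le> k ^ 2"
      by (simp add: choose_two power2_eq_square)
         (metis div_times_less_eq_dividend mult.commute mult_le_mono2 diff_le_self le_trans)
    then have "real (2 * (k choose 2)) \<le> real (k ^ 2)" by (rule of_nat_mono)
    then show ?thesis by simp
  qed
  have "real ((k choose 2) choose m) * (c1 / n) ^ m
      \<le> (exp 1 * real (k choose 2) / real m) ^ m * (c1 / n) ^ m"
    using c by (intro mult_right_mono binomial_le_exp_power) auto
  also have "\<dots> = (exp 1 * real (k choose 2) / real m * (c1 / n)) ^ m"
    by (simp only: power_mult_distrib)
  also have "\<dots> \<le> X ^ m"
  proof (intro power_mono)
    have "exp 1 * real (k choose 2) / real m \<le> exp 1 * (real k ^ 2 / 2) / (c2 * real k)"
      using choose2 m c k by (intro frac_le mult_left_mono) auto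
    also have "\<dots> = exp 1 * real k / (2 * c2)" using k by (simp add: power2_eq_square)
    finally have "exp 1 * real (k choose 2) / real m * (c1 / n)
        \<le> exp 1 * real k / (2 * c2) * (c1 / n)"
      using c by (intro mult_right_mono) auto
    also have "\<dots> = X" by (simp add: X_def x_def mult_ac)
    finally show "exp 1 * real (k choose 2) / real m * (c1 / n) \<le> X" .
  qed (use c in auto)
  also have "\<dots> = X powr real m" using X0 by (simp add: powr_realpow)
  also have "\<dots> \<le> X powr (c2 * real k)"
    using m X0 X1 by (intro powr_mono') auto
  also have "\<dots> = (X powr c2) ^ k" using X0 by (simp add: powr_realpow flip: powr_powr)
  finally have edges: "real ((k choose 2) choose m) * (c1 / n) ^ m \<le> (X powr c2) ^ k" .
  have sets: "real (n choose k) \<le> (exp 1 / x) ^ k"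
    using binomial_le_exp_power[of n k] by (simp add: x_def)
  have "real (n choose k) * (real ((k choose 2) choose m) * (c1 / n) ^ m)
      \<le> (exp 1 / x) ^ k * (X powr c2) ^ k"
    using c x by (intro mult_mono sets edges) auto
  also have "\<dots> = (exp 1 / x * X powr c2) ^ k" by (simp only: power_mult_distrib)
  also have "\<dots> \<le> (9 / 10 * (x / \<delta>) powr (c2 - 1)) ^ k"
  proof (intro power_mono)
    have "X powr c2 = (exp 1 / 10) powr c2 * (x powr c2 / \<delta> powr (c2 - 1))"
      using x a by (simp add: X_eq powr_mult powr_divide \<delta>_powr)
    also have "x powr c2 = x * x powr (c2 - 1)"
      using x by (simp add: powr_diff)
    finally have "exp 1 / x * X powr c2 = exp 1 * (exp 1 / 10) powr c2 * (x / \<delta>) powr (c2 - 1)"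
      using x \<delta>0 by (simp add: powr_divide)
    also have "\<dots> \<le> 9 / 10 * (x / \<delta>) powr (c2 - 1)"
    proof (intro mult_right_mono)
      have "(exp 1 / 10) powr c2 \<le> (exp 1 / 10 :: real) powr 1"
        using c e10 by (intro powr_mono') auto
      also have "\<dots> \<le> 3 / 10" using e10 by simp
      finally have "exp 1 * (exp 1 / 10) powr c2 \<le> 3 * (3 / 10)"
        using exp_le by (intro mult_mono) auto
      then show "exp 1 * (exp 1 / 10) powr c2 \<le> 9 / 10" by simp
    qed simp
    finally show "exp 1 / x * X powr c2 \<le> 9 / 10 * (x / \<delta>) powr (c2 - 1)" .
  qed (use x in auto)
  finally show ?thesis by (simp add: x_def mult.commute)
qed

lemma finite_size_range: "finite {k. 1 \<le> k \<and> real k \<le> y}"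
  by (rule finite_subset[of _ "{..nat \<lfloor>y\<rfloor>}"]) (auto simp: le_nat_floor)

text \<open>
  The sum has a growing range, so termwise convergence alone is not enough; since the powers of
  \<open>q\<close> dominate the terms uniformly in \<open>n\<close>, Tannery's theorem applies to the terms extended by \<open>0\<close>.
\<close>
lemma sum_dense_bound_tendsto_0:
  fixes \<delta> \<epsilon> q :: real
  assumes "\<delta> > 0" "\<epsilon> > 0" "0 \<le> q" "q < 1"
  shows "(\<lambda>n. \<Sum>k\<in>{k. 1 \<le> k \<and> real k \<le> \<delta> * real n}.
            (q * (real k / (\<delta> * real n)) powr \<epsilon>) ^ k) \<longlonglongrightarrow> 0"
proof -
  define a where "a k n = (if 1 \<le> k \<and> real k \<le> \<delta> * real n
      then (q * (real k / (\<delta> * real n)) powr \<epsilon>) ^ k else 0)" for k n :: nat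
  have fin: "finite {k. 1 \<le> k \<and> real k \<le> \<delta> * real n}" for n :: nat
    by (rule finite_size_range)
  have lim: "a k \<longlonglongrightarrow> 0" for k
  proof (cases "k = 0")
    case False
    have "(\<lambda>n. real k / (\<delta> * real n)) \<longlonglongrightarrow> 0"
      using lim_const_over_n[of "real k / \<delta>"] by simp
    then have "(\<lambda>n. (real k / (\<delta> * real n)) powr \<epsilon>) \<longlonglongrightarrow> 0"
      using assms tendsto_zero_powrI[OF _ tendsto_const] by fastforce
    then have "(\<lambda>n. (q * (real k / (\<delta> * real n)) powr \<epsilon>) ^ k) \<longlonglongrightarrow> (q * 0) ^ k"
      by (intro tendsto_intros)
    also have "(q * 0) ^ k = 0"
      using False by simp
    finally show ?thesis
      by (rule Lim_null_comparison[rotated]) (use assms in \<open>auto simp: a_def\<close>)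
  qed (simp add: a_def[abs_def])
  have bound: "norm (a k n) \<le> q ^ k" for k n
  proof (cases "1 \<le> k \<and> real k \<le> \<delta> * real n")
    case True
    then have "real k / (\<delta> * real n) \<le> 1"
      by (auto simp: divide_le_eq_1)
    then have "(real k / (\<delta> * real n)) powr \<epsilon> \<le> 1"
      using assms by (intro powr_le1) auto
    then have "(q * (real k / (\<delta> * real n)) powr \<epsilon>) ^ k \<le> q ^ k"
      using assms by (intro power_mono mult_left_le) auto
    then show ?thesis using True assms by (simp add: a_def)
  qed (use assms in \<open>auto simp: a_def\<close>)
  have "(\<lambda>n. \<Sum>k. a k n) \<longlonglongrightarrow> (\<Sum>k. 0)"
  proof -
    have "\<forall>\<^sub>F (k, n) in sequentially \<times>\<^sub>F sequentially. norm (a k n) \<le> q ^ k"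
      using bound by (auto intro!: always_eventually)
    moreover have "summable (\<lambda>k. q ^ k)"
      using assms by (simp add: summable_geometric)
    ultimately show ?thesis
      using tannerys_theorem[of a "\<lambda>_. 0" sequentially] lim by auto
  qed
  moreover have "(\<Sum>k. a k n) = (\<Sum>k\<in>{k. 1 \<le> k \<and> real k \<le> \<delta> * real n}.
      (q * (real k / (\<delta> * real n)) powr \<epsilon>) ^ k)" for n
    by (subst suminf_finite[OF fin[of n]]) (auto simp: a_def)
  ultimately show ?thesis by simp
qed

theorem proposition3:
  fixes c1 c2 \<delta> :: real
  assumes "c1 > c2" and "c2 > 1"
    and "\<delta> = (c2 / (5 * c1)) powr (c2 / (c2 - 1))"
  shows "(\<lambda>n::nat. measure_pmf.prob (gnp n (c1 / real n))
      {E. \<forall>k::nat. 1 \<le> k \<and> real k \<le> \<delta> * real n \<longrightarrow>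
        (\<forall>S. S \<subseteq> {1..n} \<and> card S = k \<longrightarrow>
          real (card (spanned_edges E S)) < c2 * real k)}) \<longlonglongrightarrow> 1"
proof -
  define K where "K n = {k. 1 \<le> k \<and> real k \<le> \<delta> * real n}" for n :: nat
  define Good where "Good n = {E. \<forall>k::nat. 1 \<le> k \<and> real k \<le> \<delta> * real n \<longrightarrow>
        (\<forall>S. S \<subseteq> {1..n} \<and> card S = k \<longrightarrow>
          real (card (spanned_edges E S)) < c2 * real k)}" for n :: nat
  define m where "m k = nat \<lceil>c2 * real k\<rceil>" for k :: nat
  define Bad where "Bad n k =
      {E. \<exists>S. S \<subseteq> {1..n} \<and> card S = k \<and> m k \<le> card (spanned_edges E S)}" for n k :: nat
  define s where "s n = (\<Sum>k\<in>K n. (9 / 10 * (real k / (\<delta> * real n)) powr (c2 - 1)) ^ k)"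
    for n :: nat
  have \<delta>0: "0 < \<delta>" using assms by simp
  have m: "c2 * real k \<le> real (m k)" for k
    by (simp add: m_def of_nat_ceiling)
  have finK: "finite (K n)" for n
    unfolding K_def by (rule finite_size_range)
  have compl: "- Good n = (\<Union>k\<in>K n. Bad n k)" for n
  proof -
    have "m k \<le> j \<longleftrightarrow> \<not> real j < c2 * real k" for k j :: nat
      by (simp add: m_def nat_ceiling_le_eq not_less)
    then show ?thesis by (auto simp: Good_def Bad_def K_def)
  qed
  have lower: "1 - s n \<le> measure_pmf.prob (gnp n (c1 / real n)) (Good n)" if n: "c1 \<le> real n" for n
  proof -
    have p: "0 \<le> c1 / real n" "c1 / real n \<le> 1" using assms n by auto
    have "measure_pmf.prob (gnp n (c1 / real n)) (- Good n)
        \<le> (\<Sum>k\<in>K n. measure_pmf.prob (gnp n (c1 / real n)) (Bad n k))"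
      unfolding compl by (rule measure_pmf.finite_measure_subadditive_finite[OF finK]) simp
    also have "\<dots> \<le> s n"
      unfolding s_def
    proof (rule sum_mono)
      fix k assume k: "k \<in> K n"
      show "measure_pmf.prob (gnp n (c1 / real n)) (Bad n k)
          \<le> (9 / 10 * (real k / (\<delta> * real n)) powr (c2 - 1)) ^ k"
        using order_trans[OF prob_dense_set_le[OF p, of n k "m k"]
            expected_dense_sets_le[OF assms, of k n "m k"]] k m[of k]
        by (simp add: Bad_def K_def)
    qed
    finally show ?thesis
      using measure_pmf.prob_compl[of "Good n" "gnp n (c1 / real n)"]
      by (simp add: Compl_eq_Diff_UNIV)
  qed
  have "s \<longlonglongrightarrow> 0"
    unfolding s_def K_def by (rule sum_dense_bound_tendsto_0) (use assms \<delta>0 in auto)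
  then have lim: "(\<lambda>n. 1 - s n) \<longlonglongrightarrow> 1" using tendsto_diff[OF tendsto_const, of s 0 _ 1] by simp
  show ?thesis
    unfolding Good_def[symmetric]
  proof (rule tendsto_sandwich[OF _ _ lim tendsto_const])
    show "\<forall>\<^sub>F n in sequentially. 1 - s n \<le> measure_pmf.prob (gnp n (c1 / real n)) (Good n)"
      using eventually_ge_at_top[of "nat \<lceil>c1\<rceil>"]
      by eventually_elim (use lower in \<open>simp add: nat_ceiling_le_eq\<close>)
  qed simp
qed

end
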